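(* Let $\mathcal M:[n]\times[d]_+\to[n]$ be $(\varepsilon/2,0)$-differentially private for counting queries such that ${\tt BasicHistogram}_{\mathcal M,\mathcal X}$ has $(a_1,\beta)$-per-query accuracy and $(a_2,\beta)$-simultaneous accuracy with $a_1\le a_2$. Then ${\tt KeepHeavy}_{\mathcal M}:\mathcal X^n\to\mathcal H_{n,n}(\mathcal X)$ satisfies: (i) it is $(\varepsilon,0)$-differentially private; (ii) it has $(a_1,2\beta)$-per-query accuracy on counts larger than $2a_2$; (iii) it has $(2a_2,\beta)$-simultaneous accuracy.
   Context: Notation: $[n]=\{0,\dots,n\}$, $[n]_+=\{1,\dots,n\}$. A dataset is $D\in\mathcal X^n$ over a finite universe $\mathcal X$ with $|\mathcal X|\ge n+1$; neighbors differ in exactly one row; $c_x(D)=|\{i:D_i=x\}|$. $(\varepsilon,\delta)$-differential privacy: for all neighbors $D,D'$ and output sets $S$, $\Pr[\mathcal M(D)\in S]\le e^\varepsilon\Pr[\mathcal M(D')\in S]+\delta$. A map $\mathcal M:[n]\times[d]_+\to[n]$ is $(\varepsilon,\delta)$-DP for counting queries if $D\in\{0,1\}^n\mapsto\mathcal M(\sum_iD_i,U)$, $U\sim\mathrm{Unif}([d]_+)$, is $(\varepsilon,\delta)$-DP. ${\tt BasicHistogram}_{\mathcal M,\mathcal X}(D)$: for each $x\in\mathcal X$ independently sample $u_x\sim\mathrm{Unif}([d]_+)$ and output $\tilde c_x=\mathcal M(c_x(D),u_x)$. ${\tt KeepHeavy}_{\mathcal M}(D)$: compute $\{\tilde c_x\}_{x\in\mathcal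 X}$ as in ${\tt BasicHistogram}_{\mathcal M,\mathcal X}(D)$; let $x_1,\dots,x_{n+1}$ be elements with the largest noisy counts in sorted order, i.e. $\tilde c_{x_1}\ge\dots\ge\tilde c_{x_{n+1}}\ge\max_{x\notin\{x_1,\dots,x_{n+1}\}}\tilde c_x$; release $h=\{(x,\tilde c_x):\tilde c_x>\tilde c_{x_{n+1}}\}$, identified with the histogram equal to $\tilde c_x$ on released $x$ and $0$ elsewhere. $\mathcal H_{n,n'}(\mathcal X)$ is the set of histograms $\mathcal X\to[n]$ with at most $n'$ nonzero values. A histogram algorithm $\mathcal H$ has $(a,\beta)$-per-query accuracy (on counts larger than $t$) if $\Pr[|\mathcal H(D)_x-c_x(D)|\le a]\ge1-\beta$ for all $D$ and all $x$ (with $c_x(D)>t$), and $(a,\beta)$-simultaneous accuracy if $\Pr[\forall x:|\mathcal H(D)_x-c_x(D)|\le a]\ge1-\beta$ for all $D$. *)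

theory Defs
  imports "HOL-Probability.Product_PMF"
begin

definition datasets :: "'a set \<Rightarrow> nat \<Rightarrow> 'a list set" where
  "datasets X n = {D. set D \<subseteq> X \<and> length D = n}"

definition neighbors :: "'a list \<Rightarrow> 'a list \<Rightarrow> bool" where
  "neighbors D D' \<longleftrightarrow> length D = length D' \<and> card {i. i < length D \<and> D ! i \<noteq> D' ! i} = 1"

definition differentially_private ::
    "real \<Rightarrow> real \<Rightarrow> 'a set \<Rightarrow> nat \<Rightarrow> ('a list \<Rightarrow> 'b pmf) \<Rightarrow> bool" where
  "differentially_private \<epsilon> \<delta> X n A \<longleftrightarrow>
     (\<forall>D \<in> datasets X n. \<forall>D' \<in> datasets X n. neighbors D D' \<longrightarrow>
       (\<forall>S. measure_pmf.prob (A D) S \<le> exp \<epsilon> * measure_pmf.prob (A D') S + \<delta>))"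

definition counting_query_dp ::
    "real \<Rightarrow> real \<Rightarrow> nat \<Rightarrow> nat \<Rightarrow> (nat \<Rightarrow> nat \<Rightarrow> nat) \<Rightarrow> bool" where
  "counting_query_dp \<epsilon> \<delta> n d M \<longleftrightarrow>
     differentially_private \<epsilon> \<delta> {0, 1 :: nat} n
       (\<lambda>D. map_pmf (\<lambda>u. M (sum_list D) u) (pmf_of_set {1..d}))"

(* A histogram over the universe X is a function that is 0 outside X. *)

definition basic_histogram ::
    "(nat \<Rightarrow> nat \<Rightarrow> nat) \<Rightarrow> nat \<Rightarrow> 'a set \<Rightarrow> 'a list \<Rightarrow> ('a \<Rightarrow> nat) pmf" where
  "basic_histogram M d X D =
     Pi_pmf X 0 (\<lambda>x. map_pmf (\<lambda>u. M (count_list D x) u) (pmf_of_set {1..d}))"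

(* xs is an admissible choice of x_1, ..., x_{n+1} for the noisy counts c. *)
definition heaviest :: "'a set \<Rightarrow> nat \<Rightarrow> ('a \<Rightarrow> nat) \<Rightarrow> 'a list \<Rightarrow> bool" where
  "heaviest X n c xs \<longleftrightarrow>
     length xs = n + 1 \<and> distinct xs \<and> set xs \<subseteq> X \<and>
     sorted_wrt (\<lambda>x y. c x \<ge> c y) xs \<and> (\<forall>y \<in> X - set xs. c (last xs) \<ge> c y)"

(* Ties are broken arbitrarily by SOME; release_heavy_eq below shows that the released
   histogram does not depend on that choice. *)
definition release_heavy :: "'a set \<Rightarrow> nat \<Rightarrow> ('a \<Rightarrow> nat) \<Rightarrow> ('a \<Rightarrow> nat)" where
  "release_heavy X n c =
     (let xs = (SOME xs. heaviest X n c xs)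
      in (\<lambda>x. if x \<in> X \<and> c x > c (last xs) then c x else 0))"

definition keep_heavy ::
    "(nat \<Rightarrow> nat \<Rightarrow> nat) \<Rightarrow> nat \<Rightarrow> nat \<Rightarrow> 'a set \<Rightarrow> 'a list \<Rightarrow> ('a \<Rightarrow> nat) pmf" where
  "keep_heavy M n d X D = map_pmf (release_heavy X n) (basic_histogram M d X D)"

definition sparse_histograms :: "'a set \<Rightarrow> nat \<Rightarrow> nat \<Rightarrow> ('a \<Rightarrow> nat) set" where
  "sparse_histograms X n n' =
     {h \<in> PiE_dflt X 0 (\<lambda>_. {0..n}). card {x \<in> X. h x \<noteq> 0} \<le> n'}"

definition per_query_accuracy_above ::
    "real \<Rightarrow> real \<Rightarrow> real \<Rightarrow> 'a set \<Rightarrow> nat \<Rightarrow> ('a list \<Rightarrow> ('a \<Rightarrow> nat) pmf) \<Rightarrow> bool" where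
  "per_query_accuracy_above t a \<beta> X n H \<longleftrightarrow>
     (\<forall>D \<in> datasets X n. \<forall>x \<in> X. real (count_list D x) > t \<longrightarrow>
       measure_pmf.prob (H D) {h. \<bar>real (h x) - real (count_list D x)\<bar> \<le> a} \<ge> 1 - \<beta>)"

definition per_query_accuracy ::
    "real \<Rightarrow> real \<Rightarrow> 'a set \<Rightarrow> nat \<Rightarrow> ('a list \<Rightarrow> ('a \<Rightarrow> nat) pmf) \<Rightarrow> bool" where
  "per_query_accuracy a \<beta> X n H \<longleftrightarrow>
     (\<forall>D \<in> datasets X n. \<forall>x \<in> X.
       measure_pmf.prob (H D) {h. \<bar>real (h x) - real (count_list D x)\<bar> \<le> a} \<ge> 1 - \<beta>)"

definition simultaneous_accuracy ::
    "real \<Rightarrow> real \<Rightarrow> 'a set \<Rightarrow> nat \<Rightarrow> ('a list \<Rightarrow> ('a \<Rightarrow> nat) pmf) \<Rightarrow> bool" where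
  "simultaneous_accuracy a \<beta> X n H \<longleftrightarrow>
     (\<forall>D \<in> datasets X n.
       measure_pmf.prob (H D) {h. \<forall>x \<in> X. \<bar>real (h x) - real (count_list D x)\<bar> \<le> a} \<ge> 1 - \<beta>)"

lemma heaviest_exists:
  assumes "finite X" "n + 1 \<le> card X"
  shows "\<exists>xs. heaviest X n c xs"
proof -
  obtain zs where zs: "set zs = X" "distinct zs"
    using assms(1) finite_distinct_list by blast
  define ys where "ys = sort_key (\<lambda>x. - int (c x)) zs"
  define xs where "xs = take (n + 1) ys"
  have ys: "set ys = X" "distinct ys" "length ys = card X"
    using zs distinct_card[of zs] by (auto simp: ys_def)
  have sys: "sorted_wrt (\<lambda>x y. c x \<ge> c y) ys"
    using sorted_sort_key[of "\<lambda>x. - int (c x)" zs]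
    by (simp add: ys_def sorted_map)
  have split: "ys = xs @ drop (n + 1) ys"
    by (simp add: xs_def)
  have len: "length xs = n + 1"
    using ys assms by (simp add: xs_def)
  then have ne: "xs \<noteq> []" by auto
  have s: "sorted_wrt (\<lambda>x y. c x \<ge> c y) (xs @ drop (n + 1) ys)"
    using sys split by metis
  have mem: "set (xs @ drop (n + 1) ys) = X"
    using ys(1) split by metis
  have "c (last xs) \<ge> c y" if "y \<in> X - set xs" for y
  proof -
    have "y \<in> set (drop (n + 1) ys)"
      using that mem by auto
    then show ?thesis
      using s ne by (auto simp: sorted_wrt_append)
  qed
  moreover have "distinct xs"
    using ys(2) by (simp add: xs_def)
  ultimately have "heaviest X n c xs"
    using s mem len by (auto simp: heaviest_def sorted_wrt_append)
  then show ?thesis ..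
qed

lemma heaviest_last_le:
  assumes xs: "heaviest X n c xs" and ys: "heaviest X n c ys"
  shows "c (last ys) \<le> c (last xs)"
proof (rule ccontr)
  assume less: "\<not> c (last ys) \<le> c (last xs)"
  have ge: "c (last ys) \<le> c y" if "y \<in> set ys" for y
  proof -
    have "ys = butlast ys @ [last ys]"
      using that by (cases ys rule: rev_cases) auto
    moreover from this have "sorted_wrt (\<lambda>x y. c x \<ge> c y) (butlast ys @ [last ys])"
      using ys by (simp add: heaviest_def)
    ultimately show ?thesis
      using that by (metis append_Nil2 in_set_conv_decomp list.set_intros(1) order_refl
          set_ConsD Un_iff set_append sorted_wrt_append empty_iff list.set(1))
  qed
  have "set ys \<subseteq> set xs"
    using ge less xs ys unfolding heaviest_def by (meson DiffI order_trans subsetD subsetI)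
  moreover have "card (set ys) = card (set xs)"
    using xs ys by (simp add: heaviest_def distinct_card)
  ultimately have "set ys = set xs"
    by (simp add: card_subset_eq)
  moreover have "last xs \<in> set xs"
    using xs by (intro last_in_set) (auto simp: heaviest_def)
  ultimately show False
    using ge less by blast
qed

lemma release_heavy_eq:
  assumes "heaviest X n c xs"
  shows "release_heavy X n c = (\<lambda>x. if x \<in> X \<and> c x > c (last xs) then c x else 0)"
proof -
  have "heaviest X n c (SOME ys. heaviest X n c ys)"
    using assms by (rule someI)
  then have "c (last (SOME ys. heaviest X n c ys)) = c (last xs)"
    using assms heaviest_last_le by (metis order_antisym)
  then show ?thesis
    by (simp add: release_heavy_def Let_def)
qed

end

theory Submission
  imports Defs
begin

text \<open>Replacing one row changes exactly two counts, each by one, so the noise distributions of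
  two coordinates change by a factor of at most exp(\<epsilon>/2) and the product distribution by exp \<epsilon>.
  Releasing the heavy elements is postprocessing. For accuracy, among the n + 1 heaviest elements
  at least one does not occur in the dataset. Hence, when all noisy counts are within a2
  of the true ones, the threshold is at most a2, and only elements of true count at most 2 * a2
  are dropped.\<close>

lemma prob_le_of_pmf_le:
  assumes "\<And>x. pmf p x \<le> c * pmf q x"
  shows "measure_pmf.prob p S \<le> c * measure_pmf.prob q S"
proof -
  have "infsetsum (pmf p) S \<le> infsetsum (\<lambda>x. c * pmf q x) S"
    using assms by (intro infsetsum_mono abs_summable_on_cmult_right) auto
  also have "\<dots> = c * infsetsum (pmf q) S"
    by (rule infsetsum_cmult_right) auto
  finally show ?thesis
    by (simp add: measure_pmf_conv_infsetsum)
qed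

lemma differentially_private_map_pmf:
  assumes "differentially_private \<epsilon> \<delta> X n A"
  shows "differentially_private \<epsilon> \<delta> X n (\<lambda>D. map_pmf f (A D))"
  using assms by (simp add: differentially_private_def)

lemma neighbors_iff:
  "neighbors D D' \<longleftrightarrow> (\<exists>as x y bs. x \<noteq> y \<and> D = as @ x # bs \<and> D' = as @ y # bs)"
proof
  assume "neighbors D D'"
  then obtain i where len: "length D = length D'"
    and i: "{i. i < length D \<and> D ! i \<noteq> D' ! i} = {i}"
    by (auto simp: neighbors_def card_1_singleton_iff)
  have iD: "i < length D" "D ! i \<noteq> D' ! i" using i by auto
  have same: "D ! j = D' ! j" if "j < length D" "j \<noteq> i" for j using i that by blast
  have "take i D' = take i D"
    using len iD same by (intro nth_equalityI) auto
  moreover have "drop (Suc i) D' = drop (Suc i) D"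
    using len iD same by (intro nth_equalityI) auto
  ultimately have "D = take i D @ D ! i # drop (Suc i) D" "D' = take i D @ D' ! i # drop (Suc i) D"
    using id_take_nth_drop[of i D] id_take_nth_drop[of i D'] iD len by auto
  then show "\<exists>as x y bs. x \<noteq> y \<and> D = as @ x # bs \<and> D' = as @ y # bs"
    using iD by blast
next
  assume "\<exists>as x y bs. x \<noteq> y \<and> D = as @ x # bs \<and> D' = as @ y # bs"
  then obtain as x y bs where D: "x \<noteq> y" "D = as @ x # bs" "D' = as @ y # bs" by blast
  have "{i. i < length D \<and> D ! i \<noteq> D' ! i} = {length as}"
    using D by (auto simp: nth_append nth_Cons' split: if_splits)
  then show "neighbors D D'" using D by (simp add: neighbors_def)
qed

lemma counting_query_dp_pmf_le:
  assumes dp: "counting_query_dp \<epsilon> 0 n d M" and k: "k < n"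
  defines "p \<equiv> \<lambda>c. map_pmf (M c) (pmf_of_set {1..d})"
  shows "pmf (p k) v \<le> exp \<epsilon> * pmf (p (Suc k)) v"
    and "pmf (p (Suc k)) v \<le> exp \<epsilon> * pmf (p k) v"
proof -
  define D where "D = (\<lambda>b::nat. replicate k 1 @ b # replicate (n - Suc k) 0)"
  have mem: "D b \<in> datasets {0, 1} n" if "b \<in> {0, 1}" for b
    using k that by (auto simp: D_def datasets_def)
  have sum: "sum_list (D b) = k + b" for b
    by (simp add: D_def sum_list_replicate)
  have "neighbors (D 0) (D 1)" "neighbors (D 1) (D 0)"
    unfolding neighbors_iff D_def by (metis zero_neq_one)+
  then have "measure_pmf.prob (p (k + 0)) {v} \<le> exp \<epsilon> * measure_pmf.prob (p (k + 1)) {v} + 0"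
    "measure_pmf.prob (p (k + 1)) {v} \<le> exp \<epsilon> * measure_pmf.prob (p (k + 0)) {v} + 0"
    using dp mem[of 0] mem[of 1]
    unfolding counting_query_dp_def differentially_private_def p_def
    by (metis (no_types, lifting) sum insertI1 insertI2)+
  then show "pmf (p k) v \<le> exp \<epsilon> * pmf (p (Suc k)) v"
    and "pmf (p (Suc k)) v \<le> exp \<epsilon> * pmf (p k) v"
    by (simp_all add: measure_pmf_single)
qed

lemma basic_histogram_dp:
  assumes fin: "finite X" and dp: "counting_query_dp (\<epsilon> / 2) 0 n d M"
  shows "differentially_private \<epsilon> 0 X n (basic_histogram M d X)"
  unfolding differentially_private_def
proof (intro ballI impI allI)
  fix D D' :: "'a list" and S
  assume D: "D \<in> datasets X n" "D' \<in> datasets X n" "neighbors D D'"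
  then obtain as x y bs where xy: "x \<noteq> y" and eq: "D = as @ x # bs" "D' = as @ y # bs"
    by (auto simp: neighbors_iff)
  have X: "x \<in> X" "y \<in> X" and len: "length as + length bs < n"
    using D eq by (auto simp: datasets_def)
  define p where "p = (\<lambda>c. map_pmf (M c) (pmf_of_set {1..d}))"
  have less: "count_list as z + count_list bs z < n" for z
    using len count_le_length[of as z] count_le_length[of bs z] by linarith
  have "pmf (basic_histogram M d X D) f \<le> exp \<epsilon> * pmf (basic_histogram M d X D') f" for f
  proof (cases "\<forall>z. z \<notin> X \<longrightarrow> f z = 0")
    case True
    define P where "P = (\<lambda>D z. pmf (p (count_list D z)) (f z))"
    have prod: "pmf (basic_histogram M d X E) f = P E x * P E y * prod (P E) (X - {x, y})" for E
    proof -
      have "pmf (basic_histogram M d X E) f = prod (P E) X"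
        using True fin by (simp add: basic_histogram_def pmf_Pi P_def p_def)
      also have "\<dots> = P E x * (P E y * prod (P E) (X - {x} - {y}))"
        using fin X xy by (subst prod.remove[of X x]; simp) (subst prod.remove[of _ y]; simp)
      also have "X - {x} - {y} = X - {x, y}" by blast
      finally show ?thesis by simp
    qed
    have "prod (P D) (X - {x, y}) = prod (P D') (X - {x, y})"
      by (rule prod.cong) (auto simp: P_def eq)
    moreover have "P D x \<le> exp (\<epsilon> / 2) * P D' x"
      using counting_query_dp_pmf_le(2)[OF dp less[of x]] xy by (simp add: P_def eq p_def)
    moreover have "P D y \<le> exp (\<epsilon> / 2) * P D' y"
      using counting_query_dp_pmf_le(1)[OF dp less[of y]] xy by (simp add: P_def eq p_def)
    moreover have nn: "P E z \<ge> 0" for E z by (simp add: P_def)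
    ultimately have "pmf (basic_histogram M d X D) f \<le>
        (exp (\<epsilon> / 2) * P D' x) * (exp (\<epsilon> / 2) * P D' y) * prod (P D') (X - {x, y})"
      unfolding prod[of D] by (auto intro!: mult_mono prod_nonneg)
    also have "\<dots> = (exp (\<epsilon> / 2) * exp (\<epsilon> / 2)) * pmf (basic_histogram M d X D') f"
      unfolding prod[of D'] by (simp only: mult_ac)
    also have "exp (\<epsilon> / 2) * exp (\<epsilon> / 2) = exp \<epsilon>"
      by (simp flip: exp_add)
    finally show ?thesis .
  next
    case False
    then show ?thesis
      using fin by (auto simp: basic_histogram_def pmf_Pi)
  qed
  then show "measure_pmf.prob (basic_histogram M d X D) S
      \<le> exp \<epsilon> * measure_pmf.prob (basic_histogram M d X D') S + 0"
    by (simp add: prob_le_of_pmf_le)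
qed

lemma set_pmf_basic_histogram:
  assumes "finite X" "d \<ge> 1" "\<forall>c \<in> {0..n}. \<forall>u \<in> {1..d}. M c u \<in> {0..n}" "length D = n"
  shows "set_pmf (basic_histogram M d X D) \<subseteq> PiE_dflt X 0 (\<lambda>_. {0..n})"
proof -
  have "count_list D x \<in> {0..n}" for x
    using count_le_length[of D x] assms(4) by simp
  then show ?thesis
    using assms(1-3) by (fastforce simp: basic_histogram_def set_Pi_pmf PiE_dflt_def set_pmf_of_set)
qed

lemma heaviest_last_le_mem:
  assumes "heaviest X n c xs" "x \<in> set xs"
  shows "c (last xs) \<le> c x"
  using assms by (cases xs rule: rev_cases) (auto simp: heaviest_def sorted_wrt_append)

lemma release_heavy_sparse:
  assumes X: "finite X" "n + 1 \<le> card X" and c: "c \<in> PiE_dflt X 0 (\<lambda>_. {0..n})"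
  shows "release_heavy X n c \<in> sparse_histograms X n n"
proof -
  obtain xs where xs: "heaviest X n c xs"
    using heaviest_exists[OF X] by blast
  have "last xs \<in> set xs" using xs by (intro last_in_set) (auto simp: heaviest_def)
  then have "card (set xs - {last xs}) = n"
    using xs by (simp add: heaviest_def distinct_card)
  moreover have "{x \<in> X. release_heavy X n c x \<noteq> 0} \<subseteq> set xs - {last xs}"
  proof
    fix x assume "x \<in> {x \<in> X. release_heavy X n c x \<noteq> 0}"
    then have "x \<in> X" "\<not> c x \<le> c (last xs)"
      by (auto simp: release_heavy_eq[OF xs] split: if_splits)
    then show "x \<in> set xs - {last xs}"
      using xs by (auto simp: heaviest_def)
  qed
  ultimately have "card {x \<in> X. release_heavy X n c x \<noteq> 0} \<le> n"
    by (metis card_mono finite_Diff finite_set)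
  then show ?thesis
    using c by (auto simp: sparse_histograms_def release_heavy_eq[OF xs] PiE_dflt_def)
qed

lemma release_heavy_cases:
  assumes X: "finite X" "n + 1 \<le> card X" and len: "length D = n" and x: "x \<in> X"
    and acc: "\<forall>x \<in> X. \<bar>real (c x) - real (count_list D x)\<bar> \<le> a"
  obtains "release_heavy X n c x = c x"
  | "release_heavy X n c x = 0" "real (count_list D x) \<le> 2 * a"
proof -
  obtain xs where xs: "heaviest X n c xs"
    using heaviest_exists[OF X] by blast
  have "card (set D) < card (set xs)"
    using card_length[of D] xs len by (simp add: heaviest_def distinct_card)
  then have "\<not> set xs \<subseteq> set D"
    by (metis List.finite_set card_mono not_less)
  then obtain z where z: "z \<in> set xs" "z \<notin> set D" by blast
  then have "real (c z) \<le> a"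
    using acc xs by (force simp: heaviest_def)
  then have "real (c (last xs)) \<le> a"
    using heaviest_last_le_mem[OF xs z(1)] by linarith
  moreover have "real (count_list D x) - real (c x) \<le> a" using acc x by force
  ultimately show ?thesis
    using that x by (cases "c x > c (last xs)") (auto simp: release_heavy_eq[OF xs])
qed

theorem theorem6p1:
  fixes X :: "'a set" and n d :: nat and M :: "nat \<Rightarrow> nat \<Rightarrow> nat"
    and \<epsilon> \<beta> a1 a2 :: real
  assumes "finite X" and "card X \<ge> n + 1" and "d \<ge> 1"
    and "\<forall>c \<in> {0..n}. \<forall>u \<in> {1..d}. M c u \<in> {0..n}"
    and "counting_query_dp (\<epsilon> / 2) 0 n d M"
    and "per_query_accuracy a1 \<beta> X n (basic_histogram M d X)"
    and "simultaneous_accuracy a2 \<beta> X n (basic_histogram M d X)"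
    and "a1 \<le> a2"
  shows "(\<forall>D \<in> datasets X n. set_pmf (keep_heavy M n d X D) \<subseteq> sparse_histograms X n n)
    \<and> differentially_private \<epsilon> 0 X n (keep_heavy M n d X)
    \<and> per_query_accuracy_above (2 * a2) a1 (2 * \<beta>) X n (keep_heavy M n d X)
    \<and> simultaneous_accuracy (2 * a2) \<beta> X n (keep_heavy M n d X)"
proof (intro conjI)
  note X = assms(1,2)
  have nonneg: "0 \<le> a2" if "\<forall>x \<in> X. \<bar>real (c x) - real (count_list D x)\<bar> \<le> a2" for c D
    using that X by (metis abs_ge_zero card.empty ex_in_conv not_one_le_zero order_trans le_add2)
  show "\<forall>D \<in> datasets X n. set_pmf (keep_heavy M n d X D) \<subseteq> sparse_histograms X n n"
    using set_pmf_basic_histogram[OF assms(1,3,4)] release_heavy_sparse[OF X]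
    by (fastforce simp: datasets_def keep_heavy_def)
  show "differentially_private \<epsilon> 0 X n (keep_heavy M n d X)"
    unfolding keep_heavy_def
    by (intro differentially_private_map_pmf basic_histogram_dp assms)
  show "per_query_accuracy_above (2 * a2) a1 (2 * \<beta>) X n (keep_heavy M n d X)"
    unfolding per_query_accuracy_above_def
  proof (intro ballI impI)
    fix D x assume D: "D \<in> datasets X n" and x: "x \<in> X" and big: "2 * a2 < real (count_list D x)"
    define p where "p = basic_histogram M d X D"
    define A where "A = {c. \<bar>real (c x) - real (count_list D x)\<bar> \<le> a1}"
    define B where "B = {c. \<forall>x \<in> X. \<bar>real (c x) - real (count_list D x)\<bar> \<le> a2}"
    have "A \<inter> B \<subseteq> release_heavy X n -` A"
    proof
      fix c assume "c \<in> A \<inter> B"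
      then have a1: "\<bar>real (c x) - real (count_list D x)\<bar> \<le> a1"
        and a2: "\<forall>x \<in> X. \<bar>real (c x) - real (count_list D x)\<bar> \<le> a2"
        by (auto simp: A_def B_def)
      have "length D = n" using D by (simp add: datasets_def)
      from X this x a2 have "release_heavy X n c x = c x"
        by (cases rule: release_heavy_cases) (use big in auto)
      then show "c \<in> release_heavy X n -` A" using a1 by (simp add: A_def)
    qed
    then have "measure_pmf.prob p (A \<inter> B) \<le> measure_pmf.prob p (release_heavy X n -` A)"
      by (intro measure_pmf.finite_measure_mono) auto
    moreover have "measure_pmf.prob p (A \<union> B) =
        measure_pmf.prob p A + measure_pmf.prob p B - measure_pmf.prob p (A \<inter> B)"
      by (rule measure_Un3) (auto simp: measure_pmf.fmeasurable_eq_sets)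
    moreover have "measure_pmf.prob p (A \<union> B) \<le> 1" by simp
    moreover have "measure_pmf.prob p A \<ge> 1 - \<beta>"
      using assms(6) D x by (simp add: per_query_accuracy_def A_def p_def)
    moreover have "measure_pmf.prob p B \<ge> 1 - \<beta>"
      using assms(7) D by (simp add: simultaneous_accuracy_def B_def p_def)
    ultimately have "1 - 2 * \<beta> \<le> measure_pmf.prob p (release_heavy X n -` A)" by linarith
    then show "1 - 2 * \<beta> \<le> measure_pmf.prob (keep_heavy M n d X D)
        {h. \<bar>real (h x) - real (count_list D x)\<bar> \<le> a1}"
      by (simp add: keep_heavy_def p_def A_def)
  qed
  show "simultaneous_accuracy (2 * a2) \<beta> X n (keep_heavy M n d X)"
    unfolding simultaneous_accuracy_def
  proof
    fix D assume D: "D \<in> datasets X n"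
    define B where "B = (\<lambda>a. {c. \<forall>x \<in> X. \<bar>real (c x) - real (count_list D x)\<bar> \<le> a})"
    have "B a2 \<subseteq> release_heavy X n -` B (2 * a2)"
    proof
      fix c assume "c \<in> B a2"
      then have acc: "\<forall>x \<in> X. \<bar>real (c x) - real (count_list D x)\<bar> \<le> a2" by (simp add: B_def)
      have "\<bar>real (release_heavy X n c x) - real (count_list D x)\<bar> \<le> 2 * a2" if "x \<in> X" for x
      proof -
        have "length D = n" using D by (simp add: datasets_def)
        from X this that acc show ?thesis
        proof (cases rule: release_heavy_cases)
          case 1
          then show ?thesis using acc that nonneg[OF acc] by force
        qed simp
      qed
      then show "c \<in> release_heavy X n -` B (2 * a2)" by (simp add: B_def)
    qed
    then have "measure_pmf.prob (basic_histogram M d X D) (B a2)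
        \<le> measure_pmf.prob (basic_histogram M d X D) (release_heavy X n -` B (2 * a2))"
      by (intro measure_pmf.finite_measure_mono) auto
    moreover have "1 - \<beta> \<le> measure_pmf.prob (basic_histogram M d X D) (B a2)"
      using assms(7) D by (simp add: simultaneous_accuracy_def B_def)
    ultimately show "1 - \<beta> \<le> measure_pmf.prob (keep_heavy M n d X D)
        {h. \<forall>x \<in> X. \<bar>real (h x) - real (count_list D x)\<bar> \<le> 2 * a2}"
      by (simp add: keep_heavy_def B_def)
  qed
qed

end
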